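(* $\tau_E(\mathcal{D}_n) = \frac{1}{2}\binom{n-1}{2} + \Theta(\log n)$ and $\tau_E(\mathcal{T}_n) = \frac{1}{2}\binom{n-1}{2} + \Theta(\log n)$; that is, there exist constants $c_1, c_2 > 0$ such that for all sufficiently large $n$, both $\tau_E(\mathcal{D}_n)$ and $\tau_E(\mathcal{T}_n)$ lie between $\frac{1}{2}\binom{n-1}{2} + c_1 \log n$ and $\frac{1}{2}\binom{n-1}{2} + c_2 \log n$.
   Context: Let $\mathcal{F}$ be a hypergraph whose vertex set is $E(K_n)$, the edge set of the complete graph on $n$ vertices; its hyperedges are called losing sets. In the unbiased Avoider-Enforcer game on $\mathcal{F}$, two players, Avoider and Enforcer, alternately claim previously unclaimed edges of $K_n$, one edge per turn, with Avoider going first, until all edges are claimed. Enforcer wins if the set of edges claimed by Avoider contains some hyperedge of $\mathcal{F}$; otherwise Avoider wins. $\tau_E(\mathcal{F})$ denotes the smallest integer $t$ such that Enforcer has a strategy guaranteeing that, whatever Avoider does, Avoider's graph contains a hyperedge of $\mathcal{F}$ after at most $t$ moves (rounds); $\tau_E(\mathcal{F})=\infty$ if Avoider wins. $\mathcal{D}_n$ is the hypergraph on $E(K_n)$ whose hyperedges are the edge sets of all graphs on the vertex set of $K_n$ with positive minimum degree (no isolated vertex), and $\mathcal{T}_n$ is the hypergraph whose hyperedges are the edge sets of all connected spanning graphs on the vertex set of $K_n$. Here $\log$ denotes the natural logarithm. *)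

theory Defs
  imports Complex_Main "HOL-Library.Ramsey" "HOL-Library.Extended_Real"
begin

(* The unbiased game on a finite board X.  A complete play is the list of all elements of X in the
   order in which they are claimed: Avoider claims the entries at even positions (and so moves
   first), Enforcer those at odd positions. *)

definition plays :: "'a set \<Rightarrow> 'a list set" where
  "plays X = {p. distinct p \<and> set p = X}"

(* An Enforcer strategy maps the moves made so far to Enforcer's next move; it must give a free
   element whenever it is Enforcer's turn. *)

definition enforcer_strategy :: "'a set \<Rightarrow> ('a list \<Rightarrow> 'a) \<Rightarrow> bool" where
  "enforcer_strategy X \<sigma> \<longleftrightarrow>
     (\<forall>h. distinct h \<and> set h \<subset> X \<and> odd (length h) \<longrightarrow> \<sigma> h \<in> X - set h)"

definition follows_strategy :: "('a list \<Rightarrow> 'a) \<Rightarrow> 'a list \<Rightarrow> bool" where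
  "follows_strategy \<sigma> p \<longleftrightarrow> (\<forall>i<length p. odd i \<longrightarrow> p ! i = \<sigma> (take i p))"

(* Avoider's first t moves; all of them if he makes fewer than t. *)

definition avoider_claims :: "nat \<Rightarrow> 'a list \<Rightarrow> 'a set" where
  "avoider_claims t p = {p ! (2 * i) | i. i < t \<and> 2 * i < length p}"

definition enforcer_wins_within :: "'a set \<Rightarrow> 'a set set \<Rightarrow> nat \<Rightarrow> bool" where
  "enforcer_wins_within X \<F> t \<longleftrightarrow>
     (\<exists>\<sigma>. enforcer_strategy X \<sigma> \<and>
        (\<forall>p\<in>plays X. follows_strategy \<sigma> p \<longrightarrow> (\<exists>L\<in>\<F>. L \<subseteq> avoider_claims t p)))"

(* The infimum of the empty set is \<infinity>, the value when Avoider wins the game. *)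

definition tau_E :: "'a set \<Rightarrow> 'a set set \<Rightarrow> enat" where
  "tau_E X \<F> = Inf {enat t | t. enforcer_wins_within X \<F> t}"

definition K_edges :: "nat \<Rightarrow> nat set set" where
  "K_edges n = [{..<n}]\<^bsup>2\<^esup>"

definition degree :: "nat set set \<Rightarrow> nat \<Rightarrow> nat" where
  "degree E v = card {e \<in> E. v \<in> e}"

(* Only meaningful for n > 0, since Min {} is unspecified. *)

definition min_degree :: "nat \<Rightarrow> nat set set \<Rightarrow> nat" where
  "min_degree n E = Min (degree E ` {..<n})"

definition connected_spanning :: "nat \<Rightarrow> nat set set \<Rightarrow> bool" where
  "connected_spanning n E \<longleftrightarrow> (\<forall>u<n. \<forall>v<n. (u, v) \<in> {(x, y). {x, y} \<in> E}\<^sup>*)"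

definition D_sets :: "nat \<Rightarrow> nat set set set" where
  "D_sets n = {E. E \<subseteq> K_edges n \<and> 0 < min_degree n E}"

definition T_sets :: "nat \<Rightarrow> nat set set set" where
  "T_sets n = {E. E \<subseteq> K_edges n \<and> connected_spanning n E}"

end

(* Enforcer plays inside the components of Avoider's graph as long as he can.  Whenever he cannot,
   Avoider's next move merges two components, so Enforcer claims fewer than n edges between
   components in total; hence every cut with at least two vertices on both sides is crossed by
   Avoider early on, and only isolated vertices matter.  If he must touch isolated vertices, Enforcer
   picks one of least Enforcer-degree; then the sum of 2^degree over the isolated vertices
   never increases, so these degrees stay below log_2 n.

   Avoider protects a set S of isolated vertices and plays edges disjoint from S while there are any.
   When they run out, he releases one or two vertices of nearly least Enforcer-degree from S,
   chosen such that an odd number of edges becomes available: then Enforcer is the first to run out of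
   them and has to touch S.  So each release raises the average Enforcer-degree of S by
   about 1 / |S|, and some isolated vertex v reaches Enforcer-degree of order log n.  From
   then on Avoider just avoids v. *)

theory Submission
  imports Defs "HOL-Real_Asymp.Real_Asymp"
begin

section \<open>Plays and strategies\<close>

text \<open>Defined for every history, complete or not, so that invariants can speak of the pair of
  claimed sets instead of the list of moves.\<close>

definition avoider_part :: "'a list \<Rightarrow> 'a set" where
  "avoider_part p = (!) p ` {i. i < length p \<and> even i}"

definition enforcer_part :: "'a list \<Rightarrow> 'a set" where
  "enforcer_part p = (!) p ` {i. i < length p \<and> odd i}"

lemma avoider_part_Nil [simp]: "avoider_part [] = {}"
  and enforcer_part_Nil [simp]: "enforcer_part [] = {}"
  by (simp_all add: avoider_part_def enforcer_part_def)

lemma avoider_part_snoc: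
  "avoider_part (p @ [x]) = (if even (length p) then insert x (avoider_part p) else avoider_part p)"
proof -
  have "{i. i < length (p @ [x]) \<and> even i} = (if even (length p)
      then insert (length p) {i. i < length p \<and> even i} else {i. i < length p \<and> even i})"
    by (auto simp: less_Suc_eq)
  moreover have "(!) (p @ [x]) ` {i. i < length p \<and> even i} = (!) p ` {i. i < length p \<and> even i}"
    by (intro image_cong) (auto simp: nth_append)
  ultimately show ?thesis
    by (simp only: avoider_part_def image_insert if_split) simp
qed

lemma enforcer_part_snoc:
  "enforcer_part (p @ [x]) = (if odd (length p) then insert x (enforcer_part p) else enforcer_part p)"
proof -
  have "{i. i < length (p @ [x]) \<and> odd i} = (if odd (length p)
      then insert (length p) {i. i < length p \<and> odd i} else {i. i < length p \<and> odd i})"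
    by (auto simp: less_Suc_eq)
  moreover have "(!) (p @ [x]) ` {i. i < length p \<and> odd i} = (!) p ` {i. i < length p \<and> odd i}"
    by (intro image_cong) (auto simp: nth_append)
  ultimately show ?thesis
    by (simp only: enforcer_part_def image_insert if_split) simp
qed

lemma parts_Un: "avoider_part p \<union> enforcer_part p = set p"
  by (auto simp: avoider_part_def enforcer_part_def set_conv_nth)

lemma parts_disjoint: "distinct p \<Longrightarrow> avoider_part p \<inter> enforcer_part p = {}"
  by (auto simp: avoider_part_def enforcer_part_def nth_eq_iff_index_eq)

lemma finite_parts [simp]: "finite (avoider_part p)" "finite (enforcer_part p)"
  by (simp_all add: avoider_part_def enforcer_part_def)

lemma card_parts:
  assumes "distinct p"
  shows "card (avoider_part p) = (length p + 1) div 2 \<and> card (enforcer_part p) = length p div 2"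
  using assms
proof (induction p rule: rev_induct)
  case (snoc x p)
  have "x \<notin> avoider_part p" "x \<notin> enforcer_part p"
    using snoc.prems parts_Un[of p] by auto
  then show ?case
    using snoc by (auto simp: avoider_part_snoc enforcer_part_snoc elim!: oddE evenE)
qed auto

lemma avoider_claims_eq: "avoider_claims t p = avoider_part (take (2 * t) p)"
proof -
  have "{p ! (2 * i) | i. i < t \<and> 2 * i < length p} = {p ! j | j. j < length p \<and> j < 2 * t \<and> even j}"
    by (auto elim!: evenE)
  then show ?thesis
    by (force simp: avoider_claims_def avoider_part_def)
qed

text \<open>The play against \<open>\<sigma>\<close> is built move by move. As nothing is known
  about \<open>\<sigma>\<close>, Avoider's move has to preserve \<open>P\<close> against every
  reply; \<open>P\<close> is claimed only for positions with Avoider to move.\<close>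

lemma avoider_play:
  assumes fin: "finite X" and \<sigma>: "enforcer_strategy X \<sigma>" and P0: "P {} {}"
    and step: "\<And>A B. \<lbrakk>P A B; A \<inter> B = {}; A \<union> B \<subset> X; card A = card B\<rbrakk> \<Longrightarrow>
      \<exists>a\<in>X - (A \<union> B). \<forall>b\<in>X - (A \<union> B) - {a}. P (insert a A) (insert b B)"
  shows "\<exists>p\<in>plays X. follows_strategy \<sigma> p \<and>
    (\<forall>i. 2 * i \<le> length p \<longrightarrow> P (avoider_part (take (2 * i) p)) (enforcer_part (take (2 * i) p)))"
proof -
  \<comment> \<open>At odd lengths \<open>Q\<close> stores the promise that every reply restores
    \<open>P\<close>, so that the induction can advance by single moves.\<close>
  define Q where "Q h \<longleftrightarrow> (if even (length h) then P (avoider_part h) (enforcer_part h)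
    else \<forall>b\<in>X - set h. P (avoider_part h) (insert b (enforcer_part h)))" for h
  have "\<exists>h. distinct h \<and> set h \<subseteq> X \<and> length h = m \<and> follows_strategy \<sigma> h \<and> (\<forall>j\<le>m. Q (take j h))"
    if "m \<le> card X" for m
    using that
  proof (induction m)
    case 0
    show ?case by (rule exI[of _ "[]"]) (simp add: follows_strategy_def Q_def P0)
  next
    case (Suc m)
    then obtain h where h: "distinct h" "set h \<subseteq> X" "length h = m" "follows_strategy \<sigma> h"
      "\<forall>j\<le>m. Q (take j h)" by auto
    have sub: "set h \<subset> X"
      using h Suc.prems distinct_card[of h] by (metis Suc_n_not_le_n psubsetI)
    have "Q h" using h by (metis order_refl take_all)
    have "\<exists>x\<in>X - set h. Q (h @ [x]) \<and> (odd m \<longrightarrow> x = \<sigma> h)"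
    proof (cases "even m")
      case True
      then have "card (avoider_part h) = card (enforcer_part h)"
        using card_parts[OF h(1)] h(3) by (auto elim!: evenE)
      then obtain a where "a \<in> X - set h"
        "\<forall>b\<in>X - set h - {a}. P (insert a (avoider_part h)) (insert b (enforcer_part h))"
        using step[of "avoider_part h" "enforcer_part h"] True \<open>Q h\<close> h(3) sub parts_Un[of h]
          parts_disjoint[OF h(1)] by (auto simp: Q_def)
      then show ?thesis
        using True h(3) by (auto simp: Q_def avoider_part_snoc enforcer_part_snoc)
    next
      case False
      then have "\<sigma> h \<in> X - set h"
        using \<sigma> h sub by (auto simp: enforcer_strategy_def)
      then show ?thesis
        using False h(3) \<open>Q h\<close> by (auto simp: Q_def avoider_part_snoc enforcer_part_snoc)
    qed
    then obtain x where x: "x \<in> X - set h" "Q (h @ [x])" "odd m \<longrightarrow> x = \<sigma> h" by blast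
    have "follows_strategy \<sigma> (h @ [x])"
      using h(3,4) x(3) by (auto simp: follows_strategy_def nth_append less_Suc_eq)
    moreover have "\<forall>j\<le>Suc m. Q (take j (h @ [x]))"
      using h(3,5) x(2) by (auto simp: le_Suc_eq)
    ultimately show ?case
      using h x by (intro exI[of _ "h @ [x]"]) auto
  qed
  from this[of "card X"] obtain p where p: "distinct p" "set p \<subseteq> X" "length p = card X"
    "follows_strategy \<sigma> p" "\<forall>j\<le>card X. Q (take j p)" by auto
  have "set p = X" using p fin by (metis card_subset_eq distinct_card)
  then have "p \<in> plays X" using p by (simp add: plays_def)
  moreover have "P (avoider_part (take (2 * i) p)) (enforcer_part (take (2 * i) p))"
    if "2 * i \<le> length p" for i
    using p(5)[rule_format, of "2 * i"] that p(3) by (simp add: Q_def min_def)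
  ultimately show ?thesis using p(4) by blast
qed

text \<open>Here \<open>J\<close> is an invariant of positions with Enforcer to move, so it must
  hold after any first move of Avoider. The strategy chooses a reply that preserves \<open>J\<close>
  whatever Avoider does next.\<close>

lemma enforcer_play:
  assumes J0: "\<And>a. a \<in> X \<Longrightarrow> J {a} {}"
    and step: "\<And>A B. \<lbrakk>J A B; A \<inter> B = {}; A \<union> B \<subset> X; card A = Suc (card B)\<rbrakk> \<Longrightarrow>
      \<exists>e\<in>X - (A \<union> B). \<forall>a\<in>X - (A \<union> B) - {e}. J (insert a A) (insert e B)"
  shows "\<exists>\<sigma>. enforcer_strategy X \<sigma> \<and> (\<forall>p\<in>plays X. follows_strategy \<sigma> p \<longrightarrow>
    (\<forall>i. 2 * i + 1 \<le> length p \<longrightarrow>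
      J (avoider_part (take (2 * i + 1) p)) (enforcer_part (take (2 * i + 1) p))))"
proof -
  define good where "good h e \<longleftrightarrow> e \<in> X - set h \<and>
    (\<forall>a\<in>X - set h - {e}. J (insert a (avoider_part h)) (insert e (enforcer_part h)))" for h e
  \<comment> \<open>A strategy must answer legally even in histories where no reply preserves
    \<open>J\<close>; there any free element is taken.\<close>
  define \<sigma> where "\<sigma> h = (if \<exists>e. good h e then SOME e. good h e else SOME e. e \<in> X - set h)" for h
  have "enforcer_strategy X \<sigma>"
    unfolding enforcer_strategy_def
  proof (intro allI impI)
    fix h :: "'a list" assume "distinct h \<and> set h \<subset> X \<and> odd (length h)"
    then have ex: "\<exists>e. e \<in> X - set h" by blast
    show "\<sigma> h \<in> X - set h"
    proof (cases "\<exists>e. good h e")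
      case True
      then have "good h (\<sigma> h)" by (simp only: \<sigma>_def if_True someI_ex[OF True])
      then show ?thesis by (simp add: good_def)
    next
      case False
      then show ?thesis using someI_ex[OF ex] by (simp only: \<sigma>_def if_False)
    qed
  qed
  moreover have "J (avoider_part (take (2 * i + 1) p)) (enforcer_part (take (2 * i + 1) p))"
    if p: "p \<in> plays X" "follows_strategy \<sigma> p" and "2 * i + 1 \<le> length p" for p i
    using that(3)
  proof (induction i)
    case 0
    then obtain a q where "p = a # q" by (cases p) auto
    then have "a \<in> X" "take (2 * 0 + 1) p = [] @ [a]"
      using p(1) by (auto simp: plays_def)
    then show ?case
      using J0 by (simp only: avoider_part_snoc enforcer_part_snoc) simp
  next
    case (Suc i)
    define h where "h = take (2 * i + 1) p"
    have len: "length h = 2 * i + 1" using Suc.prems by (simp add: h_def)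
    have d: "distinct p" "set p = X" using p(1) by (auto simp: plays_def)
    have t1: "take (2 * i + 2) p = h @ [p ! (2 * i + 1)]"
      using Suc.prems take_Suc_conv_app_nth[of "2 * i + 1" p] by (simp add: h_def)
    have t2: "take (2 * Suc i + 1) p = h @ [p ! (2 * i + 1), p ! (2 * i + 2)]"
      using Suc.prems take_Suc_conv_app_nth[of "2 * i + 2" p] t1 by simp
    have dist: "distinct (h @ [p ! (2 * i + 1), p ! (2 * i + 2)])"
      "set (h @ [p ! (2 * i + 1), p ! (2 * i + 2)]) \<subseteq> X"
      using d t2 by (metis distinct_take, metis set_take_subset)
    have e: "p ! (2 * i + 1) = \<sigma> h"
      using p(2) Suc.prems by (simp add: follows_strategy_def h_def)
    have "set h \<subset> X" using dist by auto
    moreover have "J (avoider_part h) (enforcer_part h)"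
      using Suc by (simp add: h_def)
    moreover have "card (avoider_part h) = Suc (card (enforcer_part h))"
      using card_parts[of h] dist len by auto
    ultimately have "\<exists>e. good h e"
      using step[of "avoider_part h" "enforcer_part h"] dist parts_disjoint[of h] parts_Un[of h]
      by (auto simp: good_def)
    then have "good h (\<sigma> h)" by (simp add: \<sigma>_def someI_ex)
    then have "J (insert (p ! (2 * i + 2)) (avoider_part h)) (insert (\<sigma> h) (enforcer_part h))"
      using dist e by (auto simp: good_def)
    moreover have "take (2 * Suc i + 1) p = (h @ [\<sigma> h]) @ [p ! (2 * i + 2)]"
      using t2 e by simp
    ultimately show ?case
      using len by (simp only: avoider_part_snoc enforcer_part_snoc) simp
  qed
  ultimately show ?thesis by blast
qed

text \<open>A nonempty set of extended naturals contains its infimum, so a finite value is attained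
  by some strategy.\<close>

lemma tau_E_enat:
  assumes "tau_E X F = enat t"
  shows "enforcer_wins_within X F t"
proof -
  let ?S = "{enat t | t. enforcer_wins_within X F t}"
  have "?S \<noteq> {}"
  proof
    assume "?S = {}"
    then show False using assms by (simp add: tau_E_def Inf_enat_def)
  qed
  then obtain s where s: "s \<in> ?S" by blast
  then have "Inf ?S = (LEAST x. x \<in> ?S)" by (simp only: Inf_enat_def) auto
  then have "Inf ?S \<in> ?S" using LeastI[of "\<lambda>x. x \<in> ?S", OF s] by simp
  then show ?thesis using assms by (simp add: tau_E_def)
qed

lemma tau_E_le: "enforcer_wins_within X F t \<Longrightarrow> tau_E X F \<le> enat t"
  by (auto simp: tau_E_def intro: Inf_lower)

lemma enforcer_wins_mono:
  "enforcer_wins_within X F t \<Longrightarrow> F \<subseteq> G \<Longrightarrow> enforcer_wins_within X G t"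
  unfolding enforcer_wins_within_def by (meson subsetD)

lemma tau_E_antimono: "F \<subseteq> G \<Longrightarrow> tau_E X G \<le> tau_E X F"
  unfolding tau_E_def by (rule Inf_superset_mono) (use enforcer_wins_mono in blast)

section \<open>Isolated vertices and components\<close>

lemma finite_K_edges [simp]: "finite (K_edges n)"
  by (simp add: K_edges_def finite_imp_finite_nsets)

lemma K_edges_D: "e \<in> K_edges n \<Longrightarrow> \<exists>u v. e = {u, v} \<and> u < n \<and> v < n \<and> u \<noteq> v"
  by (auto simp: K_edges_def nsets_2_eq)

lemma doubleton_in_K_edges [simp]: "{u, v} \<in> K_edges n \<longleftrightarrow> u < n \<and> v < n \<and> u \<noteq> v"
  by (simp add: K_edges_def)

lemma card_K_edges: "card (K_edges n) = n choose 2"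
  by (simp add: K_edges_def)

definition isolated :: "nat \<Rightarrow> nat set set \<Rightarrow> nat set" where
  "isolated n A = {v. v < n \<and> (\<forall>e\<in>A. v \<notin> e)}"

lemma finite_isolated [simp]: "finite (isolated n A)"
  by (simp add: isolated_def)

lemma degree_insert:
  assumes "finite B" "e \<notin> B"
  shows "degree (insert e B) v = degree B v + (if v \<in> e then 1 else 0)"
proof -
  have "{x \<in> insert e B. v \<in> x} = (if v \<in> e then insert e {x \<in> B. v \<in> x} else {x \<in> B. v \<in> x})"
    by auto
  then show ?thesis using assms by (simp add: degree_def)
qed

section \<open>Connectivity and the merging of components\<close>

definition conn :: "nat set set \<Rightarrow> nat \<Rightarrow> nat \<Rightarrow> bool" where
  "conn A u v \<longleftrightarrow> (u, v) \<in> {(x, y). {x, y} \<in> A}\<^sup>*"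

lemma conn_refl [simp]: "conn A u u"
  by (simp add: conn_def)

lemma conn_sym: "conn A u v \<Longrightarrow> conn A v u"
  unfolding conn_def by (rule symD[OF sym_rtrancl]) (auto simp: sym_def insert_commute)

lemma conn_trans: "conn A u v \<Longrightarrow> conn A v w \<Longrightarrow> conn A u w"
  unfolding conn_def by (rule rtrancl_trans)

lemma conn_edge: "{u, v} \<in> A \<Longrightarrow> conn A u v"
  unfolding conn_def by blast

lemma conn_mono: "conn A u v \<Longrightarrow> A \<subseteq> A' \<Longrightarrow> conn A' u v"
  unfolding conn_def by (erule rtrancl_mono[THEN subsetD, rotated]) auto

lemma conn_not_isolated:
  assumes "conn A u v" "u \<noteq> v"
  shows "u \<notin> isolated n A"
  using assms(1) unfolding conn_def
proof (cases rule: converse_rtranclE)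
  case (step y)
  then show ?thesis by (auto simp: isolated_def)
qed (use assms(2) in simp)

text \<open>In a cut between unions of components of \<open>A\<close>, all edges of \<open>B\<close>
  are of this kind, so their number bounds how far Enforcer can block such a cut.\<close>

definition crossing :: "nat set set \<Rightarrow> nat set set \<Rightarrow> nat set set" where
  "crossing A B = {e \<in> B. \<exists>u v. e = {u, v} \<and> \<not> conn A u v}"

lemma crossing_insert: "crossing (insert a A) (insert e B) \<subseteq> insert e (crossing A B)"
  unfolding crossing_def using conn_mono[of A _ _ "insert a A"] by blast

lemma crossing_insert_conn:
  "conn A u v \<Longrightarrow> crossing (insert a A) (insert {u, v} B) \<subseteq> crossing A B"
  unfolding crossing_def using conn_mono[of A _ _ "insert a A"] conn_sym[of "insert a A"]
  by (smt (verit, best) doubleton_eq_iff insertE mem_Collect_eq subset_iff subset_insertI)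

definition component :: "nat \<Rightarrow> nat set set \<Rightarrow> nat \<Rightarrow> nat set" where
  "component n A u = {v. v < n \<and> conn A u v}"

definition components :: "nat \<Rightarrow> nat set set \<Rightarrow> nat set set" where
  "components n A = component n A ` {..<n}"

lemma finite_components [simp]: "finite (components n A)"
  by (simp add: components_def)

lemma component_eq_iff: "u < n \<Longrightarrow> v < n \<Longrightarrow> component n A u = component n A v \<longleftrightarrow> conn A u v"
  unfolding component_def set_eq_iff mem_Collect_eq by (meson conn_refl conn_sym conn_trans)

lemma UN_component:
  assumes "A \<subseteq> A'" "u < n"
  shows "(\<Union>w\<in>component n A u. component n A' w) = component n A' u"
proof (rule set_eqI)
  fix x
  show "x \<in> (\<Union>w\<in>component n A u. component n A' w) \<longleftrightarrow> x \<in> component n A' u"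
    using assms(2) conn_mono[OF _ assms(1), of u] conn_refl[of A u] conn_trans[of A' u _ x]
    unfolding component_def UN_iff mem_Collect_eq by blast
qed

lemma components_mono_eq:
  assumes "A \<subseteq> A'"
  shows "components n A' = (\<lambda>c. \<Union>u\<in>c. component n A' u) ` components n A"
  using UN_component[OF assms] by (auto simp: components_def image_image)

lemma card_components_mono: "A \<subseteq> A' \<Longrightarrow> card (components n A') \<le> card (components n A)"
  by (simp add: components_mono_eq card_image_le)

text \<open>The map sending each old component to the new one containing it is onto. It identifies
  the components of \<open>u\<close> and \<open>v\<close>, so it is not injective and the number
  drops.\<close>

lemma card_components_insert:
  assumes "u < n" "v < n" "\<not> conn A u v"
  shows "Suc (card (components n (insert {u, v} A))) \<le> card (components n A)"
proof (rule ccontr)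
  let ?A = "insert {u, v} A"
  let ?f = "\<lambda>c. \<Union>w\<in>c. component n ?A w"
  assume "\<not> ?thesis"
  then have "card (?f ` components n A) = card (components n A)"
    using components_mono_eq[of A ?A n] card_components_mono[of A ?A n] by (simp add: subset_insertI)
  then have inj: "inj_on ?f (components n A)" by (rule eq_card_imp_inj_on[rotated]) simp
  have f: "?f (component n A w) = component n ?A w" if "w < n" for w
    using that by (intro UN_component) auto
  have "conn ?A u v" by (rule conn_edge) simp
  then have "?f (component n A u) = ?f (component n A v)"
    using assms f by (simp add: component_eq_iff)
  then have "component n A u = component n A v"
    using inj assms by (auto simp: inj_on_def components_def)
  then show False using assms by (simp add: component_eq_iff)
qed

section \<open>Enforcer's strategy\<close>

text \<open>An exponential potential: a bound \<open>n\<close> on it bounds each Enforcer-degree of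
  an isolated vertex by the binary logarithm of \<open>n\<close>.\<close>

definition weight :: "nat \<Rightarrow> nat set set \<Rightarrow> nat set set \<Rightarrow> nat" where
  "weight n A B = (\<Sum>v\<in>isolated n A. 2 ^ degree B v)"

text \<open>Describes positions with Enforcer to move. Nonemptiness of \<open>A\<close> provides
  vertices that are not isolated; the last inequality says that each crossing edge has been paid for
  by a merger of two components.\<close>

definition enforcer_inv :: "nat \<Rightarrow> nat set set \<Rightarrow> nat set set \<Rightarrow> bool" where
  "enforcer_inv n A B \<longleftrightarrow> A \<noteq> {} \<and> weight n A B \<le> n \<and> card (crossing A B) + card (components n A) \<le> n"

lemma enforcer_inv_init: "enforcer_inv n {a} {}"
proof -
  have "card (isolated n {a}) \<le> card {..<n}" by (rule card_mono) (auto simp: isolated_def)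
  moreover have "card (components n {a}) \<le> card {..<n}"
    unfolding components_def by (rule card_image_le) simp
  ultimately show ?thesis
    by (simp add: enforcer_inv_def weight_def degree_def crossing_def)
qed

lemma weight_insert_le:
  assumes "finite B" "e \<notin> B" "e \<inter> isolated n A = {}"
  shows "weight n (insert a A) (insert e B) \<le> weight n A B"
proof -
  have "weight n (insert a A) (insert e B) \<le> (\<Sum>v\<in>isolated n A. 2 ^ degree (insert e B) v)"
    unfolding weight_def by (rule sum_mono2) (auto simp: isolated_def)
  also have "\<dots> = weight n A B"
    unfolding weight_def using assms by (intro sum.cong) (auto simp: degree_insert)
  finally show ?thesis .
qed

text \<open>Enforcer raises the degree of an isolated vertex of least degree; since Avoider then has to
  touch some isolated vertex, the weight gained is lost again.\<close>

lemma weight_insert_min: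
  assumes fin: "finite B" and e: "{v, u} \<notin> B" "v \<in> isolated n A" "u \<notin> isolated n A"
    and min: "\<And>w. w \<in> isolated n A \<Longrightarrow> degree B v \<le> degree B w"
    and a: "w \<in> isolated n A" "w \<in> a"
  shows "weight n (insert a A) (insert {v, u} B) \<le> weight n A B"
proof -
  let ?I = "isolated n A" and ?d = "degree (insert {v, u} B)"
  have d: "?d x = degree B x + (if x = v then 1 else 0)" if "x \<in> ?I" for x
    using that e fin by (auto simp: degree_insert)
  have "weight n (insert a A) (insert {v, u} B) \<le> (\<Sum>x\<in>?I - {w}. 2 ^ ?d x)"
    unfolding weight_def using a by (intro sum_mono2) (auto simp: isolated_def)
  moreover have "(\<Sum>x\<in>?I. (2::nat) ^ ?d x) = 2 ^ ?d w + (\<Sum>x\<in>?I - {w}. 2 ^ ?d x)"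
    using a by (simp add: sum.remove)
  moreover have "(\<Sum>x\<in>?I. 2 ^ ?d x) = weight n A B + 2 ^ degree B v"
  proof -
    have "(\<Sum>x\<in>?I. 2 ^ ?d x) = (\<Sum>x\<in>?I. (2::nat) ^ degree B x + (if x = v then 2 ^ degree B v else (0::nat)))"
      by (intro sum.cong) (auto simp: d)
    then show ?thesis using e by (simp add: sum.distrib weight_def)
  qed
  moreover have "(2::nat) ^ degree B v \<le> 2 ^ ?d w"
    using min[OF a(1)] d[OF a(1)] by (intro power_increasing) auto
  ultimately show ?thesis by linarith
qed

text \<open>Let there be \<open>i\<close> isolated and \<open>m\<close> other vertices. If Enforcer
  owned all edges from \<open>v\<close> to the latter, all isolated vertices would have degree at
  least \<open>m\<close>, and the weight would be at least \<open>i * 2 ^ m\<close>. As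
  \<open>m\<close> is at least 2, this is at least \<open>i * (m + 2)\<close>, which exceeds
  \<open>i + m = n\<close>.\<close>

lemma isolated_min_has_free_edge:
  assumes A: "A \<subseteq> K_edges n" "A \<noteq> {}" and B: "finite B" and wt: "weight n A B \<le> n"
    and v: "v \<in> isolated n A" "\<And>w. w \<in> isolated n A \<Longrightarrow> degree B v \<le> degree B w"
  shows "\<exists>u<n. u \<notin> isolated n A \<and> {v, u} \<notin> B"
proof (rule ccontr)
  let ?I = "isolated n A"
  let ?U = "{..<n} - ?I"
  assume no: "\<not> ?thesis"
  obtain x y where xy: "{x, y} \<in> A" "x < n" "y < n" "x \<noteq> y"
    using A K_edges_D by blast
  then have "{x, y} \<subseteq> ?U" by (auto simp: isolated_def)
  then have U2: "2 \<le> card ?U" using xy card_mono[of ?U "{x, y}"] by simp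
  have I: "?I \<subseteq> {..<n}" by (auto simp: isolated_def)
  have n: "card ?I + card ?U = n"
    using card_Un_disjoint[of ?I ?U] I by (simp add: Un_absorb1)
  have pos: "1 \<le> card ?I" using v card_gt_0_iff[of ?I] by auto
  have "(\<lambda>u. {v, u}) ` ?U \<subseteq> {e \<in> B. v \<in> e}" using no by auto
  moreover have "inj_on (\<lambda>u. {v, u}) ?U" by (auto simp: inj_on_def doubleton_eq_iff)
  ultimately have U: "card ?U \<le> degree B v"
    unfolding degree_def using B by (intro card_inj_on_le) auto
  then have "card ?I * 2 ^ card ?U \<le> weight n A B"
    unfolding weight_def using sum_bounded_below[of ?I "(2::nat) ^ card ?U" "\<lambda>w. 2 ^ degree B w"]
      power_increasing[OF le_trans[OF U v(2)], of _ "2::nat"] by simp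
  also have "\<dots> \<le> n" by (fact wt)
  finally have "card ?I * 2 ^ card ?U \<le> card ?I + card ?U" using n by simp
  moreover have "m + 2 \<le> 2 ^ m" if "2 \<le> m" for m :: nat
    using that by (induction m rule: dec_induct) auto
  note this[OF U2]
  ultimately have "card ?I * (card ?U + 2) \<le> card ?I + card ?U"
    by (meson le_trans mult_le_mono2)
  moreover have "card ?U \<le> card ?I * card ?U" using pos by simp
  ultimately show False using pos by (simp add: algebra_simps)
qed

text \<open>Enforcer prefers an edge inside a component, then one that misses the isolated vertices,
  and finally one from an isolated vertex of least degree to a vertex that is not isolated.\<close>

lemma enforcer_inv_step:
  assumes inv: "enforcer_inv n A B" and X: "A \<inter> B = {}" "A \<union> B \<subset> K_edges n"
  shows "\<exists>e\<in>K_edges n - (A \<union> B). \<forall>a\<in>K_edges n - (A \<union> B) - {e}.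
    enforcer_inv n (insert a A) (insert e B)"
proof -
  let ?F = "K_edges n - (A \<union> B)" and ?I = "isolated n A"
  have fin: "finite A" "finite B" using X finite_subset[OF _ finite_K_edges] by auto
  have finc: "finite (crossing A B)" using fin by (simp add: crossing_def)
  have inv': "A \<noteq> {}" "weight n A B \<le> n" "card (crossing A B) + card (components n A) \<le> n"
    using inv by (auto simp: enforcer_inv_def)
  show ?thesis
  proof (cases "\<exists>u v. {u, v} \<in> ?F \<and> conn A u v")
    case True
    then obtain u v where uv: "{u, v} \<in> ?F" "conn A u v" by blast
    then have "u \<noteq> v" by auto
    then have "{u, v} \<inter> ?I = {}"
      using conn_not_isolated[of A u v n] conn_not_isolated[of A v u n] conn_sym uv by auto
    then have w: "weight n (insert a A) (insert {u, v} B) \<le> weight n A B" for a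
      using uv fin by (intro weight_insert_le) auto
    have "card (crossing (insert a A) (insert {u, v} B)) \<le> card (crossing A B)" for a
      using crossing_insert_conn[OF uv(2)] finc by (rule card_mono[rotated])
    moreover have "card (components n (insert a A)) \<le> card (components n A)" for a
      by (rule card_components_mono) auto
    ultimately have "enforcer_inv n (insert a A) (insert {u, v} B)" for a
      using inv' w[of a] unfolding enforcer_inv_def
      by (meson add_mono insert_not_empty le_trans)
    then show ?thesis using uv by blast
  next
    case False
    \<comment> \<open>Now every free edge joins two components, so Avoider's next move merges a pair
      and makes up for one new crossing edge.\<close>
    have count: "card (crossing (insert a A) (insert e B)) + card (components n (insert a A)) \<le> n"
      if "a \<in> ?F" for a e
    proof -
      obtain u v where uv: "a = {u, v}" "u < n" "v < n" using \<open>a \<in> ?F\<close> K_edges_D by blast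
      then have "\<not> conn A u v" using False \<open>a \<in> ?F\<close> by blast
      then have "Suc (card (components n (insert a A))) \<le> card (components n A)"
        using uv card_components_insert by simp
      moreover have "card (crossing (insert a A) (insert e B)) \<le> Suc (card (crossing A B))"
        using card_mono[OF _ crossing_insert[of a A e B]] finc card_insert_le_m1
        by (metis (no_types, lifting) card_insert_if finite_insert le_SucI order.trans order_refl)
      ultimately show ?thesis using inv' by linarith
    qed
    have "\<exists>e\<in>?F. \<forall>a\<in>?F. weight n (insert a A) (insert e B) \<le> weight n A B"
    proof (cases "\<exists>e\<in>?F. e \<inter> ?I = {}")
      case True
      then show ?thesis using weight_insert_le fin(2) by (metis DiffD2 UnCI)
    next
      case touch: False
      obtain f where "f \<in> ?F" using X by blast
      then have "?I \<noteq> {}" using touch by blast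
      then obtain v where v: "v \<in> ?I" "\<And>w. w \<in> ?I \<Longrightarrow> degree B v \<le> degree B w"
        using arg_min_if_finite[of ?I "degree B"]
        by (metis finite_isolated not_less)
      obtain u where u: "u < n" "u \<notin> ?I" "{v, u} \<notin> B"
        using isolated_min_has_free_edge[of A n B v] inv' v X fin by blast
      have "{v, u} \<in> ?F" using u v by (auto simp: isolated_def)
      \<comment> \<open>Avoider's next edge is already free now, so it touches an isolated vertex
        too.\<close>
      moreover have "weight n (insert a A) (insert {v, u} B) \<le> weight n A B" if "a \<in> ?F" for a
        using touch that weight_insert_min[OF fin(2) u(3) v(1) u(2) v(2)] by blast
      ultimately show ?thesis by blast
    qed
    then show ?thesis
      using count inv'(2) unfolding enforcer_inv_def by (meson DiffD1 insert_not_empty le_trans)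
  qed
qed


section \<open>Counting free edges after Avoider's move number \<open>t\<close>\<close>

lemma choose_two_pred: "n choose 2 = (n - 1 choose 2) + (n - 1)"
  by (cases n) (simp_all add: numeral_2_eq_2)

text \<open>All edges at an isolated vertex, and all edges of a cut along components, are free or
  Enforcer's. After \<open>2 * t - 1\<close> moves too few edges are free for either: the weight
  limits Enforcer's edges at an isolated vertex, the crossing count those in a cut.\<close>

lemma enforcer_inv_connected:
  assumes inv: "enforcer_inv n A B" and X: "A \<inter> B = {}" "A \<union> B \<subseteq> K_edges n"
    and card: "card A + card B + 1 = 2 * t"
    and t: "\<And>d. 2 ^ d \<le> n \<Longrightarrow> (n - 1 choose 2) + 1 + d < 2 * t"
  shows "connected_spanning n A"
proof -
  let ?F = "K_edges n - (A \<union> B)"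
  have fin: "finite A" "finite B" using X finite_subset[OF _ finite_K_edges] by auto
  have finc: "finite (crossing A B)" using fin by (simp add: crossing_def)
  have inv': "A \<noteq> {}" "weight n A B \<le> n" "card (crossing A B) + card (components n A) \<le> n"
    using inv by (auto simp: enforcer_inv_def)
  obtain x y where "x < n" "y < n" "x \<noteq> y" using inv'(1) X K_edges_D by blast
  then have n2: "2 \<le> n" by auto
  have "card (A \<union> B) = card A + card B" using fin X by (intro card_Un_disjoint)
  then have F: "card ?F + 2 * t = (n - 1 choose 2) + n"
    using card_Diff_subset[OF _ X(2)] card_mono[OF _ X(2)] fin card card_K_edges[of n]
      choose_two_pred[of n] n2 by simp
  have noniso: "isolated n A = {}"
  proof (rule ccontr)
    assume "isolated n A \<noteq> {}"
    then obtain w where w: "w \<in> isolated n A" by blast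
    then have wn: "w < n" by (simp add: isolated_def)
    have "(2::nat) ^ degree B w \<le> weight n A B"
      unfolding weight_def using w by (intro member_le_sum) auto
    then have "(n - 1 choose 2) + 1 + degree B w < 2 * t" using inv' by (intro t) simp
    moreover have "card ({..<n} - {w}) \<le> card ({e \<in> B. w \<in> e} \<union> ?F)"
    proof (rule card_inj_on_le)
      show "inj_on (\<lambda>x. {w, x}) ({..<n} - {w})" by (auto simp: inj_on_def doubleton_eq_iff)
      show "(\<lambda>x. {w, x}) ` ({..<n} - {w}) \<subseteq> {e \<in> B. w \<in> e} \<union> ?F"
        using w by (auto simp: isolated_def)
    qed (use fin in auto)
    then have "n - 1 \<le> degree B w + card ?F"
      using card_Un_le[of "{e \<in> B. w \<in> e}" ?F] wn by (simp add: degree_def)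
    ultimately show False using F by linarith
  qed
  have comp2: "2 \<le> card (component n A w)" if w: "w < n" for w
  proof -
    obtain e where e: "e \<in> A" "w \<in> e" using w noniso by (auto simp: isolated_def)
    then obtain x where x: "e = {w, x}" "x < n" "x \<noteq> w"
      using X K_edges_D[of e n] by auto
    then have "{w, x} \<subseteq> component n A w" using e w by (auto simp: component_def intro: conn_edge)
    then have "card {w, x} \<le> card (component n A w)" by (rule card_mono[rotated]) (simp add: component_def)
    then show ?thesis using x by simp
  qed
  have "conn A u v" if uv: "u < n" "v < n" for u v
  proof (rule ccontr)
    assume nc: "\<not> conn A u v"
    let ?C = "component n A u" and ?D = "{..<n} - component n A u"
    have finC: "finite ?C" by (simp add: component_def)
    have CD: "card ?C + card ?D = n"
      using card_Un_disjoint[of ?C ?D] finC by (simp add: Un_absorb1 component_def subset_iff)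
    have "component n A v \<subseteq> ?D"
      using nc unfolding component_def by auto (meson conn_sym conn_trans)
    then have "card (component n A v) \<le> card ?D" by (rule card_mono[rotated]) simp
    then have "2 \<le> card ?D" using comp2[OF uv(2)] by linarith
    then obtain c d where cd: "card ?C = c + 2" "card ?D = d + 2"
      using comp2[OF uv(1)] by (metis add.commute le_Suc_ex)
    have "card (?C \<times> ?D) \<le> card (crossing A B \<union> ?F)"
    proof (rule card_inj_on_le)
      show "inj_on (\<lambda>(x, y). {x, y}) (?C \<times> ?D)"
        by (auto simp: inj_on_def doubleton_eq_iff)
      have "{x, y} \<in> crossing A B \<union> ?F" if "x \<in> ?C" "y \<in> ?D" for x y
      proof -
        have "\<not> conn A x y" using that conn_trans[of A u x y] by (auto simp: component_def)
        then show ?thesis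
          using that conn_edge[of x y A] by (auto simp: crossing_def component_def)
      qed
      then show "(\<lambda>(x, y). {x, y}) ` (?C \<times> ?D) \<subseteq> crossing A B \<union> ?F"
        by (intro image_subsetI, elim SigmaE, simp only: prod.case)
    qed (use finc in auto)
    then have "(c + 2) * (d + 2) \<le> card (crossing A B) + card ?F"
      using card_Un_le[of "crossing A B" ?F] cd by (simp add: card_cartesian_product)
    moreover have "2 \<le> card (components n A)"
    proof -
      have "component n A u \<noteq> component n A v" using nc uv by (simp add: component_eq_iff)
      then show ?thesis using uv card_mono[of "components n A" "{component n A u, component n A v}"]
        by (simp add: components_def)
    qed
    moreover have "(n - 1 choose 2) + 2 < 2 * t" using t[of 1] n2 by simp
    moreover have "c + d + 4 = n" using CD cd by simp
    \<comment> \<open>There are at most \<open>n - 2\<close> crossing edges and at most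
      \<open>n - 3\<close> free ones, hence at most \<open>2 * n - 5\<close> edges in the cut; but
      with two or more vertices on both sides it has at least \<open>2 * n - 4\<close>.\<close>
    moreover have "x \<le> r + f \<Longrightarrow> 2 \<le> m \<Longrightarrow> b + 2 < s \<Longrightarrow> k = n \<Longrightarrow> f + s = b + n \<Longrightarrow> r + m \<le> n
      \<Longrightarrow> x + 5 \<le> 2 * k" for x r f m b s k :: nat
      by linarith
    ultimately have "(c + 2) * (d + 2) + 5 \<le> 2 * (c + d + 4)" using F inv'(3) by blast
    then show False by (simp add: algebra_simps)
  qed
  then show ?thesis by (simp add: connected_spanning_def conn_def)
qed

lemma enforcer_wins_T_sets:
  assumes t: "\<And>d. 2 ^ d \<le> n \<Longrightarrow> (n - 1 choose 2) + 1 + d < 2 * t"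
    and le: "2 * t \<le> (n choose 2) + 1" and t0: "0 < t"
  shows "enforcer_wins_within (K_edges n) (T_sets n) t"
proof -
  obtain \<sigma> where \<sigma>: "enforcer_strategy (K_edges n) \<sigma>"
    and inv: "\<And>p i. p \<in> plays (K_edges n) \<Longrightarrow> follows_strategy \<sigma> p \<Longrightarrow> 2 * i + 1 \<le> length p \<Longrightarrow>
      enforcer_inv n (avoider_part (take (2 * i + 1) p)) (enforcer_part (take (2 * i + 1) p))"
    using enforcer_play[of "K_edges n" "enforcer_inv n", OF enforcer_inv_init enforcer_inv_step]
    by blast
  have "avoider_claims t p \<in> T_sets n" if p: "p \<in> plays (K_edges n)" "follows_strategy \<sigma> p" for p
  proof -
    \<comment> \<open>This prefix ends with Avoider's move number \<open>t\<close>, which exists by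
      \<open>le\<close>; there the invariant is available.\<close>
    define h where "h = take (2 * (t - 1) + 1) p"
    have d: "distinct p" "set p = K_edges n" using p by (auto simp: plays_def)
    then have len: "length p = n choose 2" using distinct_card card_K_edges by metis
    have lh: "length h = 2 * (t - 1) + 1" using le len t0 by (simp add: h_def)
    have dh: "distinct h" "set h \<subseteq> K_edges n"
      using d set_take_subset[of _ p] by (auto simp: h_def)
    have "connected_spanning n (avoider_part h)"
    proof (rule enforcer_inv_connected[where B = "enforcer_part h" and t = t])
      show "enforcer_inv n (avoider_part h) (enforcer_part h)"
        using inv[OF p, of "t - 1"] le len t0 by (simp add: h_def)
      show "card (avoider_part h) + card (enforcer_part h) + 1 = 2 * t"
        using card_parts[OF dh(1)] lh t0 by auto
    qed (use t parts_disjoint[OF dh(1)] parts_Un[of h] dh in auto)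
    moreover have "avoider_claims t p = avoider_part h"
    proof (cases "length p \<le> 2 * t - 1")
      case True
      then have "h = p" "take (2 * t) p = p" using t0 by (simp_all add: h_def)
      then show ?thesis by (simp add: avoider_claims_eq)
    next
      case False
      then have "take (2 * t) p = h @ [p ! (2 * t - 1)]"
        using t0 take_Suc_conv_app_nth[of "2 * t - 1" p] by (simp add: h_def Suc_diff_Suc algebra_simps)
      then show ?thesis using lh by (simp add: avoider_claims_eq avoider_part_snoc)
    qed
    ultimately show ?thesis using parts_Un[of h] dh by (auto simp: T_sets_def)
  qed
  then show ?thesis using \<sigma> unfolding enforcer_wins_within_def by blast
qed

section \<open>Avoider's strategy\<close>

text \<open>The degree sum over \<open>S\<close>, with a bonus for Avoider when the number of free edges avoiding \<open>S\<close>
  is odd: if both players only use these edges, Enforcer runs out of them first.\<close>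

definition tempo :: "nat \<Rightarrow> nat set \<Rightarrow> nat set set \<Rightarrow> nat set set \<Rightarrow> nat" where
  "tempo n S A B = (\<Sum>v\<in>S. degree B v) + card {e \<in> K_edges n - (A \<union> B). e \<inter> S = {}} mod 2"

text \<open>If \<open>b\<close> avoids \<open>S\<close>, two edges leave the counted set and the
  parity stays. Otherwise the parity bonus may be lost, but the degree sum grows by at least
  1.\<close>

lemma tempo_step:
  assumes fin: "finite S" "finite B" and a: "a \<in> K_edges n - (A \<union> B)" "a \<inter> S = {}"
    and b: "b \<in> K_edges n - (A \<union> B) - {a}"
  shows "tempo n S A B \<le> tempo n S (insert a A) (insert b B)"
proof -
  let ?F = "{e \<in> K_edges n - (A \<union> B). e \<inter> S = {}}"
  have finF: "finite ?F" by simp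
  have aF: "a \<in> ?F" using a by simp
  have deg: "degree (insert b B) v = degree B v + (if v \<in> b then 1 else 0)" for v
    using fin b by (intro degree_insert) auto
  have F: "{e \<in> K_edges n - (insert a A \<union> insert b B). e \<inter> S = {}} = ?F - {a} - {b}"
    by auto
  show ?thesis
  proof (cases "b \<inter> S = {}")
    case True
    then have "b \<in> ?F - {a}" using b by auto
    then have "card ?F = Suc (Suc (card (?F - {a} - {b})))"
      using card.remove[OF finF aF] card.remove[of "?F - {a}" b] finF by simp
    moreover have "(\<Sum>v\<in>S. degree (insert b B) v) = (\<Sum>v\<in>S. degree B v)"
      using True by (intro sum.cong) (auto simp: deg)
    ultimately show ?thesis unfolding tempo_def F by simp
  next
    case False
    then obtain v where v: "v \<in> S" "v \<in> b" by blast
    have "card ?F = Suc (card (?F - {a}))" using finF aF by (rule card.remove)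
    moreover have "?F - {a} - {b} = ?F - {a}" using False by auto
    moreover have "(\<Sum>v\<in>S. degree B v) < (\<Sum>v\<in>S. degree (insert b B) v)"
      using fin v by (intro sum_strict_mono_ex1) (auto simp: deg)
    ultimately show ?thesis
      unfolding tempo_def F by (cases "even (card ?F)") (simp_all add: odd_iff_mod_2_eq_one)
  qed
qed

lemma ex_lowest_subset:
  fixes f :: "'a \<Rightarrow> nat"
  assumes "finite S" "k \<le> card S"
  shows "\<exists>R\<subseteq>S. card R = k \<and> (\<forall>r\<in>R. \<forall>s\<in>S - R. f r \<le> f s)"
  using assms(2)
proof (induction k)
  case (Suc k)
  then obtain R where R: "R \<subseteq> S" "card R = k" "\<forall>r\<in>R. \<forall>s\<in>S - R. f r \<le> f s" by auto
  have "S - R \<noteq> {}" using R Suc.prems assms(1) by (metis Diff_eq_empty_iff Suc_n_not_le_n subset_antisym)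
  then obtain x where x: "x \<in> S - R" "\<And>y. y \<in> S - R \<Longrightarrow> f x \<le> f y"
    using arg_min_if_finite[of "S - R" f] assms(1) by (metis finite_Diff not_less)
  have "card (insert x R) = Suc k" using x R assms(1) finite_subset by fastforce
  moreover have "\<forall>r\<in>insert x R. \<forall>s\<in>S - insert x R. f r \<le> f s" using R x by auto
  ultimately show ?case using R x by (intro exI[of _ "insert x R"]) auto
qed auto

text \<open>When every free edge meets \<open>S\<close>, Avoider releases one or two vertices of low degree from \<open>S\<close>
  so that an odd number of edges becomes available: a single vertex \<open>r\<close> with an odd number of
  free edges leaving \<open>S\<close>, or else two vertices joined by a free edge.\<close>

lemma ex_odd_release:
  assumes S: "S \<subseteq> isolated n A" and R: "R \<subseteq> S" "k < card R"
    and B: "finite B" "\<And>r. r \<in> R \<Longrightarrow> degree B r < k"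
    and touch: "\<And>e. e \<in> K_edges n - (A \<union> B) \<Longrightarrow> e \<inter> S \<noteq> {}"
  shows "\<exists>Q\<subseteq>R. Q \<noteq> {} \<and> card Q \<le> 2 \<and> odd (card {e \<in> K_edges n - (A \<union> B). e \<inter> (S - Q) = {}})"
proof -
  let ?F = "K_edges n - (A \<union> B)"
  define \<phi> where "\<phi> r = {e \<in> ?F. e \<inter> (S - {r}) = {}}" for r
  have finR: "finite R" using R(2) card.infinite[of R] by fastforce
  show ?thesis
  proof (cases "\<exists>r\<in>R. odd (card (\<phi> r))")
    case True
    then obtain r where "r \<in> R" "odd (card (\<phi> r))" by blast
    then show ?thesis by (intro exI[of _ "{r}"]) (auto simp: \<phi>_def)
  next
    case False
    obtain r where r: "r \<in> R" using R(2) by fastforce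
    \<comment> \<open>Fewer than \<open>k\<close> Enforcer edges at \<open>r\<close> cannot reach
      all of the at least \<open>k\<close> other candidates.\<close>
    have "\<exists>s\<in>R - {r}. {r, s} \<notin> B"
    proof (rule ccontr)
      assume "\<not> ?thesis"
      then have "card (R - {r}) \<le> degree B r"
        unfolding degree_def using B(1)
        by (intro card_inj_on_le[of "\<lambda>s. {r, s}"]) (auto simp: inj_on_def doubleton_eq_iff)
      then show False using B(2)[OF r] R(2) r by simp
    qed
    then obtain s where s: "s \<in> R" "s \<noteq> r" "{r, s} \<notin> B" by blast
    have rs: "{r, s} \<in> ?F" using r s S R(1) by (auto simp: isolated_def)
    \<comment> \<open>Releasing \<open>r\<close> and \<open>s\<close> together frees two disjoint
      families of even size and the edge between \<open>r\<close> and \<open>s\<close>: an odd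
      number in total.\<close>
    have U: "{e \<in> ?F. e \<inter> (S - {r, s}) = {}} = insert {r, s} (\<phi> r \<union> \<phi> s)" (is "?L = ?R")
    proof
      show "?L \<subseteq> ?R"
      proof
        fix e assume e: "e \<in> ?L"
        then obtain u v where uv: "e = {u, v}" using K_edges_D[of e n] by blast
        then show "e \<in> ?R" using e by (auto simp: \<phi>_def)
      qed
      show "?R \<subseteq> ?L" using rs by (auto simp: \<phi>_def)
    qed
    have disj: "\<phi> r \<inter> \<phi> s = {}" "{r, s} \<notin> \<phi> r \<union> \<phi> s"
      using touch r s R(1) unfolding \<phi>_def by blast+
    have "card (insert {r, s} (\<phi> r \<union> \<phi> s)) = Suc (card (\<phi> r) + card (\<phi> s))"
      using disj by (simp add: card_Un_disjoint \<phi>_def)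
    then have "odd (card {e \<in> ?F. e \<inter> (S - {r, s}) = {}})"
      using U False r s by simp
    then show ?thesis using r s by (intro exI[of _ "{r, s}"]) auto
  qed
qed

text \<open>Lower bound for the degree sum over a set with \<open>y + k + 1\<close> vertices, of which \<open>k + 1\<close> are
  kept as candidates for release: a release of \<open>q\<close> vertices costs at most the fraction \<open>q / y\<close> of the
  sum and gains 1, so the sum divided by \<open>y\<close> grows like half a harmonic sum.\<close>

definition profile :: "real \<Rightarrow> real \<Rightarrow> real" where
  "profile N y = y / 2 * ln (N / y)"

text \<open>By \<open>ln x <= x - 1\<close>, shrinking \<open>y\<close> by \<open>q\<close> costs at
  most \<open>q / 2\<close> beyond the proportional loss. The factor 1/2 in \<open>profile\<close>
  makes this at most the gain 1 even for \<open>q = 2\<close>.\<close>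

lemma profile_step:
  assumes y: "0 \<le> q" "q \<le> 2" "0 < y - q" and N: "0 < N" and W: "profile N y \<le> W"
    and W': "W * (1 - q / y) + 1 \<le> W'"
  shows "profile N (y - q) \<le> W'"
proof -
  have cancel: "d / 2 * (q / d) = q / 2" if "0 < d" for d :: real using that by simp
  have "ln (y / (y - q)) \<le> y / (y - q) - 1" using y by (intro ln_le_minus_one) simp
  also have "\<dots> = q / (y - q)" using y by (simp add: field_simps)
  finally have "(y - q) / 2 * ln (y / (y - q)) \<le> (y - q) / 2 * (q / (y - q))"
    using y by (intro mult_left_mono) auto
  also have "\<dots> = q / 2" by (rule cancel[OF y(3)])
  also have "\<dots> \<le> 1" using y by simp
  finally have l: "(y - q) / 2 * ln (y / (y - q)) \<le> 1" .
  have "ln (N / (y - q)) = ln (N / y) + ln (y / (y - q))"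
    using y N by (simp add: ln_div)
  then have "profile N (y - q) = profile N y * (1 - q / y) + (y - q) / 2 * ln (y / (y - q))"
    using y by (simp add: profile_def field_simps)
  also have "\<dots> \<le> W * (1 - q / y) + 1"
    using l W y by (intro add_mono mult_right_mono) auto
  finally show ?thesis using W' by linarith
qed

text \<open>The parameter \<open>k\<close> is the Enforcer-degree aimed at. Initially
  \<open>S\<close> consists of all vertices and the logarithm in the profile vanishes.\<close>

definition avoider_inv :: "nat \<Rightarrow> nat \<Rightarrow> nat set set \<Rightarrow> nat set set \<Rightarrow> bool" where
  "avoider_inv n k A B \<longleftrightarrow> (\<exists>S\<subseteq>isolated n A. 2 * k + 2 \<le> card S \<and>
     profile (real (n - (k + 1))) (real (card S - (k + 1))) \<le> real (tempo n S A B))"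

lemma avoider_inv_init:
  assumes "2 * k + 2 \<le> n"
  shows "avoider_inv n k {} {}"
  unfolding avoider_inv_def
  by (rule exI[of _ "{..<n}"]) (use assms in \<open>auto simp: isolated_def profile_def\<close>)

text \<open>Avoider plays off \<open>S\<close>, after a release if necessary. While all isolated
  vertices have degree below \<open>k\<close>, \<open>S\<close> cannot become too small for a
  release, since by \<open>big\<close> the profile would then force a larger degree sum.\<close>

lemma avoider_inv_step:
  assumes inv: "avoider_inv n k A B" and X: "A \<inter> B = {}" "A \<union> B \<subset> K_edges n"
    and low: "\<And>v. v \<in> isolated n A \<Longrightarrow> degree B v < k"
    and big: "real (4 * k + 2) < ln (real (n - (k + 1)) / real (k + 2))"
  shows "\<exists>a\<in>K_edges n - (A \<union> B). \<forall>b\<in>K_edges n - (A \<union> B) - {a}.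
    avoider_inv n k (insert a A) (insert b B)"
proof -
  let ?F = "K_edges n - (A \<union> B)" and ?N = "real (n - (k + 1))"
  obtain S where S: "S \<subseteq> isolated n A" "2 * k + 2 \<le> card S"
    "profile ?N (real (card S - (k + 1))) \<le> real (tempo n S A B)"
    using inv by (auto simp: avoider_inv_def)
  have finS: "finite S" using S(1) by (meson finite_isolated finite_subset)
  have finB: "finite B" using X finite_subset[OF _ finite_K_edges, of B n] by auto
  have Npos: "0 < ?N"
  proof (rule ccontr)
    assume "\<not> ?thesis"
    \<comment> \<open>The convention \<open>ln 0 = 0\<close> contradicts \<open>big\<close>.\<close>
    then have "?N = 0" by linarith
    then show False using big by simp
  qed
  have move: "\<exists>a\<in>?F. \<forall>b\<in>?F - {a}. avoider_inv n k (insert a A) (insert b B)"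
    if S': "S' \<subseteq> S" "2 * k + 2 \<le> card S'"
      and p: "profile ?N (real (card S' - (k + 1))) \<le> real (tempo n S' A B)"
      and a: "a \<in> ?F" "a \<inter> S' = {}" for S' a
  proof (intro bexI[of _ a] ballI)
    fix b assume b: "b \<in> ?F - {a}"
    have "S' \<subseteq> isolated n (insert a A)" using S(1) S'(1) a(2) by (auto simp: isolated_def)
    moreover have "tempo n S' A B \<le> tempo n S' (insert a A) (insert b B)"
      using S'(1) finS finite_subset finB a b by (intro tempo_step) auto
    ultimately show "avoider_inv n k (insert a A) (insert b B)"
      using S'(2) p unfolding avoider_inv_def by (intro exI[of _ S'] conjI) simp_all
  qed (fact a)
  show ?thesis
  proof (cases "\<exists>a\<in>?F. a \<inter> S = {}")
    case True
    then show ?thesis using move[OF subset_refl S(2,3)] by blast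
  next
    case touch: False
    define W where "W = (\<Sum>v\<in>S. degree B v)"
    define y where "y = card S - (k + 1)"
    have none: "{e \<in> ?F. e \<inter> S = {}} = {}" using touch by blast
    have prof: "profile ?N (real y) \<le> real W"
      using S(3) unfolding tempo_def none by (simp add: W_def y_def)
    \<comment> \<open>Two vertices can then be released and \<open>y\<close> stays at least
      \<open>k + 1\<close>. Otherwise \<open>W\<close> would be at most
      \<open>(2 * k + 3) * k\<close>, while the profile is at least
      \<open>(k + 1) * (2 * k + 1)\<close>, which is larger by 1; this is where
      \<open>4 * k + 2\<close> comes from.\<close>
    have y: "k + 3 \<le> y"
    proof (rule ccontr)
      assume "\<not> ?thesis"
      then have y': "y = k + 1 \<or> y = k + 2" using S(2) by (auto simp: y_def)
      have "W \<le> card S * k"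
        unfolding W_def using low S(1) sum_bounded_above[of S "degree B" k] by (fastforce simp: less_imp_le)
      also have "\<dots> \<le> (2 * k + 3) * k" using y' by (intro mult_right_mono) (auto simp: y_def)
      finally have "real W \<le> real ((2 * k + 3) * k)" by (rule of_nat_mono)
      moreover have "ln (?N / real (k + 2)) \<le> ln (?N / real y)"
        using y' Npos by (intro ln_mono divide_left_mono) auto
      then have "real (k + 1) / 2 * real (4 * k + 2) \<le> real y / 2 * ln (?N / real y)"
        using y' big by (intro mult_mono) auto
      ultimately show False using prof by (auto simp: profile_def algebra_simps add_divide_distrib)
    qed
    obtain R where R: "R \<subseteq> S" "card R = k + 1" "\<forall>r\<in>R. \<forall>s\<in>S - R. degree B r \<le> degree B s"
      using ex_lowest_subset[OF finS, of "k + 1" "degree B"] S(2) by auto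
    have cSR: "card (S - R) = y"
      using R finS by (simp add: y_def card_Diff_subset finite_subset)
    have "k < card R" using R(2) by simp
    moreover have "degree B r < k" if "r \<in> R" for r using that R(1) S(1) low by blast
    moreover have "e \<inter> S \<noteq> {}" if "e \<in> ?F" for e using that touch by blast
    ultimately obtain Q where Q: "Q \<subseteq> R" "Q \<noteq> {}" "card Q \<le> 2"
      "odd (card {e \<in> ?F. e \<inter> (S - Q) = {}})"
      using ex_odd_release[OF S(1) R(1) _ finB] by blast
    have finQ: "finite Q" using Q(1) R(1) finS by (meson finite_subset)
    have QS: "Q \<subseteq> S" using Q(1) R(1) by auto
    define q where "q = card Q"
    have cS': "card (S - Q) = card S - q" using QS finQ by (simp add: card_Diff_subset q_def)
    \<comment> \<open>The \<open>y\<close> vertices outside \<open>R\<close> have at least the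
      degree of \<open>r\<close>, so each released vertex takes away at most the fraction
      \<open>1 / y\<close> of \<open>W\<close>.\<close>
    have "y * degree B r \<le> W" if "r \<in> Q" for r
    proof -
      have "y * degree B r \<le> (\<Sum>s\<in>S - R. degree B s)"
        using sum_bounded_below[of "S - R" "degree B r" "degree B"] R(3) Q(1) that cSR by auto
      also have "\<dots> \<le> W" unfolding W_def using finS by (intro sum_mono2) auto
      finally show ?thesis .
    qed
    then have "(\<Sum>r\<in>Q. y * degree B r) \<le> q * W"
      using sum_bounded_above[of Q "\<lambda>r. y * degree B r" W] by (simp add: q_def)
    then have "y * (\<Sum>r\<in>Q. degree B r) \<le> q * W" by (simp add: sum_distrib_left)
    then have loss: "real y * real (\<Sum>r\<in>Q. degree B r) \<le> real q * real W"
      by (metis of_nat_le_iff of_nat_mult)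
    have "W = (\<Sum>r\<in>Q. degree B r) + (\<Sum>s\<in>S - Q. degree B s)"
      unfolding W_def using finS QS by (simp add: sum.subset_diff add.commute)
    then have W': "real W = real (\<Sum>r\<in>Q. degree B r) + real (\<Sum>s\<in>S - Q. degree B s)"
      by (metis of_nat_add)
    \<comment> \<open>No free edge avoided \<open>S\<close>, so the bonus was 0; after the release
      it is 1. This is the gain needed in \<open>profile_step\<close>.\<close>
    have "card {e \<in> ?F. e \<inter> (S - Q) = {}} mod 2 = 1" using Q(4) by presburger
    then have "tempo n (S - Q) A B = (\<Sum>s\<in>S - Q. degree B s) + 1" by (simp add: tempo_def)
    moreover have "real (\<Sum>r\<in>Q. degree B r) \<le> real q * real W / real y"
      using loss y by (simp only: pos_le_divide_eq mult.commute[of "real y"])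
    then have "real W * (1 - real q / real y) \<le> real (\<Sum>s\<in>S - Q. degree B s)"
      using W' by (simp only: right_diff_distrib mult_1_right times_divide_eq_right
          mult.commute[of "real q"])
    ultimately have "profile ?N (real y - real q) \<le> real (tempo n (S - Q) A B)"
      using y Q(3) Npos prof by (intro profile_step[of "real q" "real y" ?N "real W"]) (auto simp: q_def)
    moreover have "real y - real q = real (card (S - Q) - (k + 1))"
      using cS' y Q(3) by (simp add: y_def q_def of_nat_diff)
    moreover have "2 * k + 2 \<le> card (S - Q)" using cS' y Q(3) by (simp add: y_def q_def)
    moreover have "{e \<in> ?F. e \<inter> (S - Q) = {}} \<noteq> {}"
      using Q(4) by (rule odd_card_imp_not_empty)
    then obtain a where "a \<in> ?F" "a \<inter> (S - Q) = {}" by blast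
    ultimately show ?thesis using move[of "S - Q" a] by simp
  qed
qed

text \<open>With fewer rounds, Avoider keeps \<open>avoider_inv\<close> until an isolated vertex has
  Enforcer-degree \<open>k\<close>, and from then on avoids that vertex. The \<open>k\<close> edges
  wasted there by Enforcer leave enough other edges for \<open>t\<close> moves.\<close>

lemma enforcer_wins_D_sets_imp:
  assumes wins: "enforcer_wins_within (K_edges n) (D_sets n) t"
    and k: "2 * k + 2 \<le> n" and big: "real (4 * k + 2) < ln (real (n - (k + 1)) / real (k + 2))"
  shows "(n - 1 choose 2) + k + 2 \<le> 2 * t"
proof (rule ccontr)
  assume "\<not> ?thesis"
  then have t: "2 * t \<le> (n - 1 choose 2) + k + 1" by simp
  obtain \<sigma> where \<sigma>: "enforcer_strategy (K_edges n) \<sigma>"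
    and win: "\<And>p. p \<in> plays (K_edges n) \<Longrightarrow> follows_strategy \<sigma> p \<Longrightarrow> \<exists>L\<in>D_sets n. L \<subseteq> avoider_claims t p"
    using wins by (auto simp: enforcer_wins_within_def)
  define P where "P A B \<longleftrightarrow> card A \<le> t \<longrightarrow>
    (\<exists>v\<in>isolated n A. k \<le> degree B v) \<or> avoider_inv n k A B" for A B
  have "P {} {}" using avoider_inv_init[OF k] by (simp add: P_def)
  moreover have "\<exists>a\<in>K_edges n - (A \<union> B). \<forall>b\<in>K_edges n - (A \<union> B) - {a}. P (insert a A) (insert b B)"
    if PAB: "P A B" and X: "A \<inter> B = {}" "A \<union> B \<subset> K_edges n" and card: "card A = card B" for A B
  proof -
    let ?F = "K_edges n - (A \<union> B)"
    have fin: "finite A" "finite B" using X finite_subset[OF _ finite_K_edges, of _ n] by auto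
    consider "t \<le> card A" | v where "card A < t" "v \<in> isolated n A" "k \<le> degree B v"
      | "card A < t" "\<And>v. v \<in> isolated n A \<Longrightarrow> degree B v < k"
      by (meson not_less)
    then show ?thesis
    proof cases
      case 1
      obtain a where "a \<in> ?F" using X by blast
      then show ?thesis using 1 fin by (intro bexI[of _ a]) (auto simp: P_def)
    next
      case 2
      have vn: "v < n" using 2 by (simp add: isolated_def)
      let ?V = "{e \<in> K_edges n. v \<in> e}"
      have "?V \<subseteq> (\<lambda>x. {v, x}) ` ({..<n} - {v})"
      proof
        fix e assume e: "e \<in> ?V"
        then obtain x y where "e = {x, y}" "x < n" "y < n" "x \<noteq> y" using K_edges_D by blast
        then show "e \<in> (\<lambda>x. {v, x}) ` ({..<n} - {v})" using e by (auto simp: insert_commute)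
      qed
      then have "card ?V \<le> card ((\<lambda>x. {v, x}) ` ({..<n} - {v}))" by (intro card_mono) auto
      also have "\<dots> \<le> card ({..<n} - {v})" by (rule card_image_le) simp
      finally have V: "card ?V \<le> n - 1" using vn by simp
      \<comment> \<open>At least \<open>n - 1 choose 2\<close> edges avoid \<open>v\<close>. Of
        these at most \<open>2 * (t - 1) - k\<close> are claimed, which is fewer by the bound on
        \<open>t\<close>.\<close>
      have "\<exists>a\<in>?F. v \<notin> a"
      proof (rule ccontr)
        assume "\<not> ?thesis"
        then have "K_edges n \<subseteq> ?V \<union> A \<union> {e \<in> B. v \<notin> e}" by blast
        then have "card (K_edges n) \<le> card (?V \<union> A \<union> {e \<in> B. v \<notin> e})"
          using fin by (intro card_mono) auto
        also have "\<dots> \<le> card ?V + card A + card {e \<in> B. v \<notin> e}"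
          using card_Un_le[of "?V \<union> A" "{e \<in> B. v \<notin> e}"] card_Un_le[of ?V A] by linarith
        finally have "n choose 2 \<le> (n - 1) + card A + card {e \<in> B. v \<notin> e}"
          using V by (simp add: card_K_edges)
        moreover have "degree B v + card {e \<in> B. v \<notin> e} = card B"
          unfolding degree_def using fin
          by (subst card_Un_disjoint[symmetric]) (auto intro: arg_cong[where f = card])
        ultimately show False
          using 2 t card choose_two_pred[of n] by linarith
      qed
      then obtain a where a: "a \<in> ?F" "v \<notin> a" by blast
      have "v \<in> isolated n (insert a A)" using 2 a by (auto simp: isolated_def)
      moreover have "k \<le> degree (insert b B) v" if "b \<in> ?F - {a}" for b
        using 2 that fin by (simp add: degree_insert)
      ultimately show ?thesis using a by (auto simp: P_def)
    next
      case 3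
      then have "avoider_inv n k A B" using PAB unfolding P_def by (meson less_imp_le not_less)
      from avoider_inv_step[OF this X 3(2) big] show ?thesis unfolding P_def by blast
    qed
  qed
  ultimately obtain p where p: "p \<in> plays (K_edges n)" "follows_strategy \<sigma> p"
    and inv: "\<And>i. 2 * i \<le> length p \<Longrightarrow> P (avoider_part (take (2 * i) p)) (enforcer_part (take (2 * i) p))"
    using avoider_play[OF finite_K_edges \<sigma>, of P] by blast
  let ?h = "take (2 * t) p"
  have d: "distinct p" "set p = K_edges n" using p by (auto simp: plays_def)
  then have len: "length p = n choose 2" using distinct_card card_K_edges by metis
  have le: "2 * t \<le> length p" using t k len choose_two_pred[of n] by simp
  have "card (avoider_part ?h) = t"
    using card_parts[of ?h] d le by simp
  \<comment> \<open>In the second alternative of \<open>P\<close> the set \<open>S\<close> has at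
    least two elements, all isolated.\<close>
  then have "isolated n (avoider_part ?h) \<noteq> {}"
    using inv[OF le] unfolding P_def avoider_inv_def by fastforce
  then obtain v where v: "v < n" "\<And>e. e \<in> avoider_part ?h \<Longrightarrow> v \<notin> e" by (auto simp: isolated_def)
  obtain L where L: "L \<in> D_sets n" "L \<subseteq> avoider_part ?h" using win[OF p] by (auto simp: avoider_claims_eq)
  have "{e \<in> L. v \<in> e} = {}" using L v by blast
  then have "degree L v = 0" by (simp only: degree_def card.empty)
  moreover have "min_degree n L \<le> degree L v"
    unfolding min_degree_def using v by (intro Min_le) auto
  ultimately show False using L by (simp add: D_sets_def)
qed

lemma T_sets_subset_D_sets:
  assumes "2 \<le> n"
  shows "T_sets n \<subseteq> D_sets n"
proof
  fix E assume "E \<in> T_sets n"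
  then have E: "E \<subseteq> K_edges n" "\<And>u v. u < n \<Longrightarrow> v < n \<Longrightarrow> conn E u v"
    by (auto simp: T_sets_def connected_spanning_def conn_def)
  have "0 < degree E u" if u: "u < n" for u
  proof -
    obtain v where "v < n" "u \<noteq> v" using assms that[of "if u = 0 then 1 else 0"] by (auto split: if_splits)
    then have "u \<notin> isolated n E" using E(2)[OF u] conn_not_isolated by blast
    moreover have "finite E" using E(1) by (meson finite_K_edges finite_subset)
    ultimately show ?thesis using u by (auto simp: isolated_def degree_def card_gt_0_iff)
  qed
  then have "0 < Min (degree E ` {..<n})" using assms by (subst Min_gr_iff) (auto simp: lessThan_empty_iff)
  then show "E \<in> D_sets n" using E(1) by (simp add: D_sets_def min_degree_def)
qed

section \<open>Asymptotics\<close>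

text \<open>Take \<open>k\<close> as the integer part of \<open>ln n / 8\<close>: then
  \<open>4 * k\<close> is about half of \<open>ln n\<close> at most, below a right side of order
  \<open>ln n\<close>. Halving the bound on \<open>2 * t\<close> turns 1/8 into 1/16.\<close>

lemma tau_E_D_sets_ge:
  assumes big: "4 * (ln (real n) / 8) + 2 < ln ((real n - ln (real n) / 8 - 1) / (ln (real n) / 8 + 2))"
    and n: "2 * (ln (real n) / 8) + 2 \<le> real n"
  shows "ereal (1 / 2 * real ((n - 1) choose 2) + 1 / 16 * ln (real n))
    \<le> ereal_of_enat (tau_E (K_edges n) (D_sets n))"
proof (cases "tau_E (K_edges n) (D_sets n)")
  case (enat t)
  define k where "k = nat \<lfloor>ln (real n) / 8\<rfloor>"
  have "n \<noteq> 0" using n by (cases n) auto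
  then have l: "0 \<le> ln (real n)" by simp
  have k: "real k \<le> ln (real n) / 8" "ln (real n) / 8 < real k + 1"
    using l unfolding k_def by linarith+
  have kn: "2 * k + 2 \<le> n" using k n by linarith
  have "real (4 * k + 2) \<le> 4 * (ln (real n) / 8) + 2" using k by simp
  also have "\<dots> < ln ((real n - ln (real n) / 8 - 1) / (ln (real n) / 8 + 2))" by (fact big)
  also have "\<dots> \<le> ln (real (n - (k + 1)) / real (k + 2))"
  proof (rule ln_mono)
    have "1 \<le> n - (k + 1)" using kn by simp
    then have r: "real (n - (k + 1)) = real n - real k - 1" using kn by (simp add: of_nat_diff)
    have pos: "0 < real n - ln (real n) / 8 - 1" using n l by linarith
    then show "0 < (real n - ln (real n) / 8 - 1) / (ln (real n) / 8 + 2)" using l by simp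
    show "(real n - ln (real n) / 8 - 1) / (ln (real n) / 8 + 2) \<le> real (n - (k + 1)) / real (k + 2)"
      unfolding r using k l pos by (intro frac_le) auto
  qed
  finally have "(n - 1 choose 2) + k + 2 \<le> 2 * t"
    by (intro enforcer_wins_D_sets_imp[OF tau_E_enat[OF enat] kn])
  then have "real ((n - 1 choose 2) + k + 2) \<le> real (2 * t)" by (rule of_nat_mono)
  then show ?thesis using enat k by simp
qed simp

lemma tau_E_T_sets_le:
  assumes n: "2 \<le> ln (real n)" "4 * ln (real n) \<le> real n"
  shows "ereal_of_enat (tau_E (K_edges n) (T_sets n))
    \<le> ereal (1 / 2 * real ((n - 1) choose 2) + 2 * ln (real n))"
proof -
  define C where "C = (n - 1 choose 2)"
  define t where "t = nat \<lfloor>1 / 2 * real C + 2 * ln (real n)\<rfloor>"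
  have n1: "1 \<le> n" using n by (cases n) auto
  have t: "real t \<le> 1 / 2 * real C + 2 * ln (real n)" "1 / 2 * real C + 2 * ln (real n) < real t + 1"
    using n unfolding t_def by linarith+
  have "enforcer_wins_within (K_edges n) (T_sets n) t"
  proof (rule enforcer_wins_T_sets)
    fix d :: nat assume "2 ^ d \<le> n"
    then have "(2::real) ^ d \<le> real n" by (metis of_nat_le_iff of_nat_numeral of_nat_power)
    then have "ln ((2::real) ^ d) \<le> ln (real n)" by (intro ln_mono) auto
    then have "real d * ln 2 \<le> ln (real n)" by (simp add: ln_realpow)
    \<comment> \<open>This bounds \<open>d\<close> by \<open>2 * ln n\<close>, while
      \<open>2 * t\<close> exceeds the binomial coefficient by more than
      \<open>4 * ln n - 2\<close>.\<close>
    moreover have "1 / 2 \<le> ln (2::real)"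
      using ln_le_minus_one[of "1 / 2 :: real"] by (simp add: ln_div)
    then have "real d * (1 / 2) \<le> real d * ln 2" by (intro mult_left_mono) auto
    ultimately have "real (C + 1 + d) < real (2 * t)" using t n by simp
    then show "(n - 1 choose 2) + 1 + d < 2 * t" unfolding C_def by (simp only: of_nat_less_iff)
  next
    have "real (2 * t) \<le> real (C + (n - 1) + 1)" using t n n1 by (simp add: of_nat_diff)
    then have "2 * t \<le> C + (n - 1) + 1" by (simp only: of_nat_le_iff)
    then show "2 * t \<le> (n choose 2) + 1" using choose_two_pred[of n] by (simp add: C_def)
    have "0 < real t" using t n by linarith
    then show "0 < t" by simp
  qed
  then have "tau_E (K_edges n) (T_sets n) \<le> enat t" by (rule tau_E_le)
  then have "ereal_of_enat (tau_E (K_edges n) (T_sets n)) \<le> ereal (real t)"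
    by (metis ereal_of_enat_le_iff ereal_of_enat_simps(1))
  also have "\<dots> \<le> ereal (1 / 2 * real ((n - 1) choose 2) + 2 * ln (real n))"
    using t by (simp add: C_def)
  finally show ?thesis .
qed

theorem theorem3:
  shows "\<exists>c1 c2 :: real. 0 < c1 \<and> 0 < c2 \<and>
    (\<forall>\<^sub>F n :: nat in sequentially.
       ereal (1 / 2 * real ((n - 1) choose 2) + c1 * ln (real n))
         \<le> ereal_of_enat (tau_E (K_edges n) (D_sets n)) \<and>
       ereal_of_enat (tau_E (K_edges n) (D_sets n))
         \<le> ereal (1 / 2 * real ((n - 1) choose 2) + c2 * ln (real n)) \<and>
       ereal (1 / 2 * real ((n - 1) choose 2) + c1 * ln (real n))
         \<le> ereal_of_enat (tau_E (K_edges n) (T_sets n)) \<and>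
       ereal_of_enat (tau_E (K_edges n) (T_sets n))
         \<le> ereal (1 / 2 * real ((n - 1) choose 2) + c2 * ln (real n)))"
proof (intro exI conjI)
  have "\<forall>\<^sub>F n :: nat in sequentially.
    4 * (ln (real n) / 8) + 2 < ln ((real n - ln (real n) / 8 - 1) / (ln (real n) / 8 + 2))"
    by real_asymp
  moreover have "\<forall>\<^sub>F n :: nat in sequentially. 2 * (ln (real n) / 8) + 2 \<le> real n"
    by real_asymp
  moreover have "\<forall>\<^sub>F n :: nat in sequentially. 2 \<le> ln (real n)"
    by real_asymp
  moreover have "\<forall>\<^sub>F n :: nat in sequentially. 4 * ln (real n) \<le> real n"
    by real_asymp
  moreover have "\<forall>\<^sub>F n :: nat in sequentially. 2 \<le> n"
    by (rule eventually_ge_at_top)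
  ultimately show "\<forall>\<^sub>F n :: nat in sequentially.
       ereal (1 / 2 * real ((n - 1) choose 2) + 1 / 16 * ln (real n))
         \<le> ereal_of_enat (tau_E (K_edges n) (D_sets n)) \<and>
       ereal_of_enat (tau_E (K_edges n) (D_sets n))
         \<le> ereal (1 / 2 * real ((n - 1) choose 2) + 2 * ln (real n)) \<and>
       ereal (1 / 2 * real ((n - 1) choose 2) + 1 / 16 * ln (real n))
         \<le> ereal_of_enat (tau_E (K_edges n) (T_sets n)) \<and>
       ereal_of_enat (tau_E (K_edges n) (T_sets n))
         \<le> ereal (1 / 2 * real ((n - 1) choose 2) + 2 * ln (real n))"
  proof eventually_elim
    case (elim n)
    \<comment> \<open>Additional losing sets only help Enforcer, so the lower bound for
      \<open>D_sets\<close> and the upper bound for \<open>T_sets\<close> yield all four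
      inequalities.\<close>
    have "ereal_of_enat (tau_E (K_edges n) (D_sets n)) \<le> ereal_of_enat (tau_E (K_edges n) (T_sets n))"
      using tau_E_antimono[OF T_sets_subset_D_sets[OF elim(5)]] by simp
    then show ?case
      using tau_E_D_sets_ge[OF elim(1,2)] tau_E_T_sets_le[OF elim(3,4)] by (meson order_trans)
  qed
qed simp_all

end
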